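(* Let $(\mathcal{T},\mathcal{H},\Lambda)$ be a space over a structured topological space $(\mathcal{H},\mathscr{S})$ such that the set of functions $H(\mathcal{T})$ is endowed with a compatible structure $\mathscr{Z}$ for which a structure basis exists, and let $P(\mathcal{T})$ denote the structure basis. Let $N\in\mathbb{N}$. A function $f:\mathcal{T}\to End(\mathcal{H})$ is in $H_N(\mathcal{T})$ if and only if for every $X_1,\dots,X_N\in\mathcal{T}$ and $v_1,\dots,v_N\in\mathcal{H}$, $$\bigoplus_{i=1}^Nf(X_i)v_i\in\overline{\{\oplus_{i=1}^Np(X_i)v_i \mid p\in P(\mathcal{T})\}}.$$ Namely, if $P(\mathcal{T})$ has the finite exact approximation property, then $f\in H_N(\mathcal{T})$ if and only if for every $X_1,\dots,X_N\in\mathcal{T}$ and $v_1,\dots,v_N\in\mathcal{H}$ there exists $p\in P(\mathcal{T})$ such that $f(X_i)v_i=p(X_i)v_i$ for $i=1,\dots,N$.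
   Context: A structured topological space $(\mathcal{H},\mathscr{S})$ is a topological space $\mathcal{H}$ together with a structure $\mathscr{S}$, i.e. a collection of subsets of the finite powers $\mathcal{H}^n$, such that (1) $S\in\mathscr{S}\Rightarrow\overline{S}\in\mathscr{S}$; (2) for each finite sequence of indices $i_1,\dots,i_n$ the block diagonal set $\{(v_{i_1},\dots,v_{i_n}) \mid v_i\in\mathcal{H}\}$ is in $\mathscr{S}$. Members of $\mathscr{S}$ are called structured. A structure is regular if it is closed under arbitrary intersections. $End(\mathcal{H})$ is the set of continuous maps $X:\mathcal{H}\to\mathcal{H}$ such that for all $m,n$ and all $S\in\mathscr{S}$ with $S\subseteq\mathcal{H}^{n+m+1}$ one has $(\mathrm{id}_{\mathcal{H}}^{\oplus m}\oplus X\oplus\mathrm{id}_{\mathcal{H}}^{\oplus n})S\in\mathscr{S}$ ($\oplus$ of maps acts coordinatewise). $End(\mathcal{H})$ has the topology of pointwise convergence. A space over $\mathcal{H}$ is a triple $(\mathcal{T},\mathcal{H},\Lambda)$ where $\mathcal{T}$ is a set and $\Lambda$ is a collection of maps $\lambda:\mathcal{T}\to End(\mathcal{H})$ separating the points of $\mathcal{T}$; $\mathcal{T}$ is given the weak topology induced by $\Lambda$. For $X_1,\dots,X_n\in\mathcal{T}$, a set $S\subseteq\mathcal{H}^{nm}$ is jointly invariant for $\oplus_{i=1}^nX_i$ if $(\oplus_{i=1}^n\lambda(X_i))^{\oplus m}S\subseteq S$ for all $\lambda\in\Lambda$. $H(\mathcal{T})$ is the set of invariant structure preserving functions $f:\mathcal{T}\to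 End(\mathcal{H})$: for every $n\in\mathbb{N}$, all $X_1,\dots,X_n\in\mathcal{T}$ and every closed structured $S$ jointly invariant for $\oplus_{i=1}^nX_i$, the set $S$ is jointly invariant for $\oplus_{i=1}^nf(X_i)$, i.e. $(\oplus_{i=1}^n f(X_i))^{\oplus m}S\subseteq S$ when $S\subseteq\mathcal{H}^{nm}$. For fixed $N$, $H_N(\mathcal{T})$ is the set of $N$-invariant structure preserving functions $f:\mathcal{T}\to End(\mathcal{H})$: for all $X_1,\dots,X_N\in\mathcal{T}$ and every closed structured $S$ jointly invariant for $\oplus_{i=1}^NX_i$, the set $S$ is jointly invariant for $\oplus_{i=1}^Nf(X_i)$ (same meaning, with $n=N$). A compatible structure on $H(\mathcal{T})$ is a collection $\mathscr{Z}$ of subsets of the powers $H(\mathcal{T})^n$ such that: (1) $(H(\mathcal{T}),\mathscr{Z})$ is a structured topological space, where $H(\mathcal{T})$ has the topology of pointwise convergence ($f_\alpha\to f$ iff $f_\alpha(X)v\to f(X)v$ for all $X\in\mathcal{T}$, $v\in\mathcal{H}$); (2) every $Z\in\mathscr{Z}$ is closed under pointwise composition; (3) every $Z\in\mathscr{Z}$ with $Z\subseteq H(\mathcal{T})^n$ contains $\mathrm{id}_{\mathcal{H}^n}$ (the $n$-tuple of constant functions equal to $\mathrm{id}_{\mathcal{H}}$); (4) for any $Z\in\mathscr{Z}$, $X_1,\dots,X_n\in\mathcal{T}$ and $v_1,\dots,v_n\in\mathcal{H}$, the set $\{\oplus_{i=1}^nf_i(X_i)v_i \mid \oplus_{i=1}^nf_i\in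 Z\}$ is in $\mathscr{S}$. A structure basis is a structured set of functions $\mathscr{B}$ (i.e. $\mathscr{B}\in\mathscr{Z}$) that contains the maps $\lambda\in\Lambda$. If $\mathscr{Z}$ is regular, there is a unique smallest structure basis, and $P(\mathcal{T})$ denotes it; otherwise $P(\mathcal{T})$ denotes some structure basis. $P(\mathcal{T})$ has the finite exact approximation property if for every $X_1,\dots,X_n\in\mathcal{T}$ and $v_1,\dots,v_n\in\mathcal{H}$ the set $\{\oplus_{i=1}^np(X_i)v_i \mid p\in P(\mathcal{T})\}$ is closed.
   Formalization: As stated the equivalence fails: N vectors characterize only invariance of sets S in H^N (m=1); membership in H_N is matched with all Nm vectors, each X_i repeated m times. Condition (4) is assumed for n-tuples of functions repeated m times, at nm points and vectors. *)

theory Defs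
  imports "HOL-Analysis.Analysis"
begin

text \<open>The point $(v_1,\dots,v_n)$ of the power $X^n$ is the extensional function on $\{0,\dots,n-1\}$
  (so indices are shifted by one). A collection of subsets of the finite powers is a family
  \<open>S\<close>, where \<open>S n\<close> collects the members that are subsets of the \<open>n\<close>-th power.\<close>

definition tuple :: "nat \<Rightarrow> (nat \<Rightarrow> 'a) \<Rightarrow> nat \<Rightarrow> 'a" where
  "tuple n v = restrict v {..<n}"

definition power_top :: "'a topology \<Rightarrow> nat \<Rightarrow> (nat \<Rightarrow> 'a) topology" where
  "power_top X n = product_topology (\<lambda>_. X) {..<n}"

type_synonym 'a power_sets = "nat \<Rightarrow> (nat \<Rightarrow> 'a) set set"

definition structured_space :: "'a topology \<Rightarrow> 'a power_sets \<Rightarrow> bool" where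
  "structured_space X S \<longleftrightarrow>
     (\<forall>n. \<forall>A\<in>S n. A \<subseteq> topspace (power_top X n)) \<and>
     (\<forall>n. \<forall>A\<in>S n. power_top X n closure_of A \<in> S n) \<and>
     (\<forall>n (i :: nat \<Rightarrow> nat). {tuple n (\<lambda>k. v (i k)) | v. \<forall>j. v j \<in> topspace X} \<in> S n)"

text \<open>Intersections are taken among subsets of one and the same power.\<close>

definition regular_structure :: "'a power_sets \<Rightarrow> bool" where
  "regular_structure S \<longleftrightarrow> (\<forall>n F. F \<subseteq> S n \<and> F \<noteq> {} \<longrightarrow> \<Inter>F \<in> S n)"

text \<open>\<open>dsum n F\<close> is the map $F_1 \oplus \dots \oplus F_n$ on the \<open>n\<close>-th power.\<close>

definition dsum :: "nat \<Rightarrow> (nat \<Rightarrow> 'a \<Rightarrow> 'a) \<Rightarrow> (nat \<Rightarrow> 'a) \<Rightarrow> nat \<Rightarrow> 'a" where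
  "dsum n F s = tuple n (\<lambda>k. F k (s k))"

definition End_H :: "'h::topological_space power_sets \<Rightarrow> ('h \<Rightarrow> 'h) set" where
  "End_H S = {X. continuous_on UNIV X \<and>
     (\<forall>m n. \<forall>A\<in>S (n + m + 1). dsum (n + m + 1) (\<lambda>k. if k = m then X else id) ` A \<in> S (n + m + 1))}"

definition space_over :: "'h::topological_space power_sets \<Rightarrow> ('t \<Rightarrow> 'h \<Rightarrow> 'h) set \<Rightarrow> bool" where
  "space_over S L \<longleftrightarrow> L \<subseteq> (UNIV \<rightarrow> End_H S) \<and> (\<forall>x y. x \<noteq> y \<longrightarrow> (\<exists>l\<in>L. l x \<noteq> l y))"

text \<open>Invariance of $A \subseteq H^{nm}$ under $(F_1 \oplus \dots \oplus F_n)^{\oplus m}$: the coordinate \<open>k\<close>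
  is acted on by \<open>F (k mod n)\<close>.\<close>

definition invariant_under :: "nat \<Rightarrow> nat \<Rightarrow> (nat \<Rightarrow> 'h \<Rightarrow> 'h) \<Rightarrow> (nat \<Rightarrow> 'h) set \<Rightarrow> bool" where
  "invariant_under n m F A \<longleftrightarrow> dsum (n * m) (\<lambda>k. F (k mod n)) ` A \<subseteq> A"

definition jointly_invariant ::
    "('t \<Rightarrow> 'h \<Rightarrow> 'h) set \<Rightarrow> nat \<Rightarrow> nat \<Rightarrow> (nat \<Rightarrow> 't) \<Rightarrow> (nat \<Rightarrow> 'h) set \<Rightarrow> bool" where
  "jointly_invariant L n m X A \<longleftrightarrow> (\<forall>l\<in>L. invariant_under n m (\<lambda>i. l (X i)) A)"

text \<open>The functions into \<open>End_H S\<close> that preserve joint invariance of closed structured subsets of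
  the \<open>n * m\<close>-th power, for \<open>n\<close> points of the domain and fixed multiplicity \<open>m\<close>. Only the values
  \<open>X i\<close> with \<open>i < n\<close> matter. The multiplicity is a parameter because, for fixed \<open>n\<close>, approximation on
  \<open>n\<close> vectors characterises the level \<open>m = 1\<close> only; \<open>H_N\<close> below allows every \<open>m\<close> and
  corresponds to approximation on all tuples of \<open>n * m\<close> vectors. The two differ: on a discrete four-point
  space where all sets are structured, with one-point domain and a single coordinate map with value
  $A = (1\,2)(3\,4)$, the function with value $(1\,2)$ agrees at each single vector with
  $\mathrm{id}$ or $A$, but does not preserve the $A$-invariant set $\{(1,3),(2,4)\}$.\<close>

definition H_level ::
    "'h::topological_space power_sets \<Rightarrow> ('t \<Rightarrow> 'h \<Rightarrow> 'h) set \<Rightarrow> nat \<Rightarrow> nat \<Rightarrow> ('t \<Rightarrow> 'h \<Rightarrow> 'h) set" where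
  "H_level S L n m = {f \<in> UNIV \<rightarrow> End_H S. \<forall>X. \<forall>A\<in>S (n * m).
     closedin (power_top euclidean (n * m)) A \<and> jointly_invariant L n m X A
       \<longrightarrow> invariant_under n m (\<lambda>i. f (X i)) A}"

definition H_N ::
    "'h::topological_space power_sets \<Rightarrow> ('t \<Rightarrow> 'h \<Rightarrow> 'h) set \<Rightarrow> nat \<Rightarrow> ('t \<Rightarrow> 'h \<Rightarrow> 'h) set" where
  "H_N S L N = (\<Inter>m. H_level S L N m)"

definition H_all ::
    "'h::topological_space power_sets \<Rightarrow> ('t \<Rightarrow> 'h \<Rightarrow> 'h) set \<Rightarrow> ('t \<Rightarrow> 'h \<Rightarrow> 'h) set" where
  "H_all S L = (\<Inter>n. H_N S L n)"

text \<open>The instance of the class \<open>topological_space\<close> for functions is the product topology, so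
  \<open>top_of_set (H_all S L)\<close> carries the topology of pointwise convergence.

  In the last condition the number of points and vectors is not tied to the arity of \<open>A\<close>: an
  \<open>n\<close>-tuple of functions acts on $H^{nm}$ by repeating it \<open>m\<close> times, just as in the definition of
  joint invariance. In particular, for a set \<open>P\<close> of functions (\<open>n = 1\<close>) all sets
  $\{\oplus_i\, p(X_i)v_i \mid p \in P\}$ are structured.\<close>

definition compatible_structure ::
    "'h::topological_space power_sets \<Rightarrow> ('t \<Rightarrow> 'h \<Rightarrow> 'h) set \<Rightarrow> ('t \<Rightarrow> 'h \<Rightarrow> 'h) power_sets \<Rightarrow> bool" where
  "compatible_structure S L Z \<longleftrightarrow>
     structured_space (top_of_set (H_all S L)) Z \<and>
     (\<forall>n. \<forall>A\<in>Z n. \<forall>f\<in>A. \<forall>g\<in>A. tuple n (\<lambda>i x. f i x \<circ> g i x) \<in> A) \<and>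
     (\<forall>n. \<forall>A\<in>Z n. tuple n (\<lambda>i x. id) \<in> A) \<and>
     (\<forall>n m. \<forall>A\<in>Z n. \<forall>X v. {tuple (n * m) (\<lambda>k. f (k mod n) (X k) (v k)) | f. f \<in> A} \<in> S (n * m))"

definition structure_basis ::
    "('t \<Rightarrow> 'h \<Rightarrow> 'h) set \<Rightarrow> ('t \<Rightarrow> 'h \<Rightarrow> 'h) power_sets \<Rightarrow> ('t \<Rightarrow> 'h \<Rightarrow> 'h) set \<Rightarrow> bool" where
  "structure_basis L Z B \<longleftrightarrow> {tuple 1 (\<lambda>_. b) | b. b \<in> B} \<in> Z 1 \<and> L \<subseteq> B"

text \<open>\<open>denotes_P L Z P\<close>: \<open>P\<close> is an admissible choice of the structure basis $P(T)$, i.e. the smallest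
  one if \<open>Z\<close> is regular and any one otherwise.\<close>

definition denotes_P ::
    "('t \<Rightarrow> 'h \<Rightarrow> 'h) set \<Rightarrow> ('t \<Rightarrow> 'h \<Rightarrow> 'h) power_sets \<Rightarrow> ('t \<Rightarrow> 'h \<Rightarrow> 'h) set \<Rightarrow> bool" where
  "denotes_P L Z P \<longleftrightarrow> structure_basis L Z P \<and>
     (regular_structure Z \<longrightarrow> (\<forall>B. structure_basis L Z B \<longrightarrow> P \<subseteq> B))"

definition values_at ::
    "('t \<Rightarrow> 'h \<Rightarrow> 'h) set \<Rightarrow> nat \<Rightarrow> (nat \<Rightarrow> 't) \<Rightarrow> (nat \<Rightarrow> 'h) \<Rightarrow> (nat \<Rightarrow> 'h) set" where
  "values_at P n X v = {tuple n (\<lambda>i. p (X i) (v i)) | p. p \<in> P}"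

definition finite_exact_approximation :: "('t \<Rightarrow> 'h::topological_space \<Rightarrow> 'h) set \<Rightarrow> bool" where
  "finite_exact_approximation P \<longleftrightarrow>
     (\<forall>n X v. closedin (power_top euclidean n) (values_at P n X v))"

end

theory Submission
  imports Defs
begin

text \<open>Fix points \<open>X\<close> and vectors \<open>v\<close>, and let \<open>V\<close> be the set of the tuples that the members of \<open>P\<close>
  produce at these points and vectors. Everything rests on the fact that the closure of \<open>V\<close> is the
  smallest closed structured set that contains \<open>v\<close> and is jointly invariant at \<open>X\<close>.

  On the one hand, the closure of \<open>V\<close> is such a set. It is structured because compatibility makes
  \<open>V\<close> structured and closures of structured sets are structured, and it contains \<open>v\<close> because \<open>P\<close> contains the constant identity. It is
  invariant because \<open>P\<close> is closed under pointwise composition and contains the coordinate maps, so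
  that a coordinate map carries \<open>V\<close> into \<open>V\<close>; since the values of coordinate maps are continuous,
  this passes to the closure (\<open>closure_values_at_jointly_invariant\<close>). A function
  that preserves joint invariance therefore sends \<open>v\<close> into this closure
  (\<open>H_level_imp_approximable\<close>).

  On the other hand, let \<open>A\<close> be any closed structured jointly invariant set that contains \<open>v\<close>. The
  structure on the functions lives on invariant structure preserving functions, so every member of
  \<open>P\<close> preserves \<open>A\<close>. Hence \<open>V\<close> and its closure lie in \<open>A\<close>, and a function whose values lie in these
  closures preserves \<open>A\<close> (\<open>approximable_imp_H_level\<close>).

  The argument treats each multiplicity \<open>m\<close> separately. Multiplicity one is approximation on
  \<open>N\<close> vectors, and all multiplicities together give \<open>H_N\<close>. When the sets \<open>V\<close> are closed, membership
  in the closure is exact interpolation.\<close>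

lemma tuple_apply [simp]: "k < n \<Longrightarrow> tuple n v k = v k"
  by (simp add: tuple_def)

lemma tuple_cong: "(\<And>k. k < n \<Longrightarrow> v k = w k) \<Longrightarrow> tuple n v = tuple n w"
  by (auto simp: tuple_def restrict_def)

lemma tuple_eq_iff: "tuple n v = tuple n w \<longleftrightarrow> (\<forall>k<n. v k = w k)"
  by (metis tuple_apply tuple_cong)

lemma dsum_tuple: "dsum n F (tuple n v) = tuple n (\<lambda>k. F k (v k))"
  unfolding dsum_def by (rule tuple_cong) simp

lemma topspace_power_top_euclidean:
  "topspace (power_top euclidean n) = extensional {..<n}"
  by (simp add: power_top_def PiE_UNIV_domain PiE_def)

lemma tuple_in_topspace: "tuple n v \<in> topspace (power_top euclidean n)"
  by (simp add: topspace_power_top_euclidean tuple_def)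

lemma values_at_subset_topspace:
  "values_at P n X v \<subseteq> topspace (power_top euclidean n)"
  using tuple_in_topspace by (auto simp: values_at_def)

lemma tuple_in_values_at: "p \<in> P \<Longrightarrow> tuple n (\<lambda>i. p (X i) (v i)) \<in> values_at P n X v"
  unfolding values_at_def by (intro CollectI exI[of _ p] conjI refl)

lemma tuple_in_values_at_iff:
  "tuple n (\<lambda>i. f (X i) (v i)) \<in> values_at P n X v
     \<longleftrightarrow> (\<exists>p\<in>P. \<forall>i<n. f (X i) (v i) = p (X i) (v i))"
  by (auto simp: values_at_def tuple_eq_iff)

lemma continuous_map_dsum:
  assumes "\<And>k. k < n \<Longrightarrow> continuous_on UNIV (F k)"
  shows "continuous_map (power_top euclidean n) (power_top euclidean n) (dsum n F)"
  unfolding power_top_def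
proof (rule continuous_map_componentwise[THEN iffD2], intro conjI ballI)
  show "dsum n F ` topspace (product_topology (\<lambda>_. euclidean) {..<n}) \<subseteq> extensional {..<n}"
    by (auto simp: dsum_def tuple_def)
next
  fix k assume k: "k \<in> {..<n}"
  have "continuous_map (product_topology (\<lambda>_. euclidean) {..<n}) euclidean (\<lambda>s. s k)"
    using k by (rule continuous_map_product_projection)
  moreover have "continuous_map euclidean euclidean (F k)"
    using assms k by simp
  ultimately have "continuous_map (product_topology (\<lambda>_. euclidean) {..<n}) euclidean
      (F k \<circ> (\<lambda>s. s k))"
    by (rule continuous_map_compose)
  then show "continuous_map (product_topology (\<lambda>_. euclidean) {..<n}) euclidean
      (\<lambda>s. dsum n F s k)"
    using k by (simp add: dsum_def o_def)
qed

lemma values_at_cong: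
  assumes "\<And>i. i < n \<Longrightarrow> X i = Y i"
  shows "values_at P n X v = values_at P n Y v"
  unfolding values_at_def by (auto simp: assms tuple_eq_iff)

section \<open>Structure bases\<close>

text \<open>A basis enters the structure through its copy among the one-tuples of functions. The next
  lemmas read off, for the functions themselves, what compatibility asserts about that copy.\<close>

lemma structure_basis_id:
  assumes "compatible_structure S L Z" and "structure_basis L Z P"
  shows "(\<lambda>x. id) \<in> P"
proof -
  let ?A = "{tuple 1 (\<lambda>_. b) | b. b \<in> P}"
  have "?A \<in> Z 1"
    using assms(2) by (simp only: structure_basis_def)
  moreover have "\<forall>n. \<forall>A\<in>Z n. tuple n (\<lambda>i x. id) \<in> A"
    using assms(1) unfolding compatible_structure_def by (elim conjE)
  ultimately have "tuple 1 (\<lambda>i x. id) \<in> ?A" by (simp only:)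
  then show ?thesis by (auto simp: tuple_eq_iff)
qed

lemma structure_basis_comp:
  assumes "compatible_structure S L Z" and "structure_basis L Z P"
    and "p \<in> P" and "q \<in> P"
  shows "(\<lambda>x. p x \<circ> q x) \<in> P"
proof -
  let ?A = "{tuple 1 (\<lambda>_. b) | b. b \<in> P}"
  have A: "?A \<in> Z 1"
    using assms(2) by (simp only: structure_basis_def)
  have "\<forall>n. \<forall>A\<in>Z n. \<forall>f\<in>A. \<forall>g\<in>A. tuple n (\<lambda>i x. f i x \<circ> g i x) \<in> A"
    using assms(1) unfolding compatible_structure_def by (elim conjE)
  note comp = this[rule_format, OF A]
  have "tuple 1 (\<lambda>_. p) \<in> ?A" and "tuple 1 (\<lambda>_. q) \<in> ?A"
    using assms(3,4) by auto
  then have "tuple 1 (\<lambda>i x. tuple 1 (\<lambda>_. p) i x \<circ> tuple 1 (\<lambda>_. q) i x) \<in> ?A"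
    by (rule comp)
  then show ?thesis by (auto simp: tuple_eq_iff)
qed

lemma structure_basis_subset_H_all:
  assumes "compatible_structure S L Z" and "structure_basis L Z P"
  shows "P \<subseteq> H_all S L"
proof
  let ?A = "{tuple 1 (\<lambda>_. b) | b. b \<in> P}"
  let ?T = "power_top (top_of_set (H_all S L)) 1"
  fix p assume "p \<in> P"
  then have "tuple 1 (\<lambda>_. p) \<in> ?A" by auto
  moreover have "\<forall>n. \<forall>A\<in>Z n. A \<subseteq> topspace (power_top (top_of_set (H_all S L)) n)"
    using assms(1) unfolding compatible_structure_def structured_space_def by (elim conjE)
  then have "?A \<subseteq> topspace ?T"
    using assms(2) by (simp only: structure_basis_def)
  ultimately have "tuple 1 (\<lambda>_. p) \<in> topspace ?T" by (rule rev_subsetD)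
  then have "tuple 1 (\<lambda>_. p) 0 \<in> H_all S L"
    unfolding power_top_def topspace_product_topology
    by (auto dest: PiE_mem[where x = 0] simp del: tuple_apply)
  then show "p \<in> H_all S L" by simp
qed

text \<open>Here the single function \<open>p\<close> is evaluated \<open>n\<close> times: in the last compatibility condition the
  arity is one and the multiplicity is \<open>n\<close>.\<close>

lemma values_at_structured:
  assumes "compatible_structure S L Z" and "structure_basis L Z P"
  shows "values_at P n X v \<in> S n"
proof -
  let ?A = "{tuple 1 (\<lambda>_. b) | b. b \<in> P}"
  have A: "?A \<in> Z 1"
    using assms(2) by (simp only: structure_basis_def)
  have "\<forall>n m. \<forall>A\<in>Z n. \<forall>X v.
      {tuple (n * m) (\<lambda>k. g (k mod n) (X k) (v k)) | g. g \<in> A} \<in> S (n * m)"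
    using assms(1) unfolding compatible_structure_def by (elim conjE)
  note evaluation = this[rule_format, OF A]
  have "{tuple (1 * n) (\<lambda>k. g (k mod 1) (X k) (v k)) | g. g \<in> ?A} = values_at P n X v"
    (is "?E = _")
  proof (intro equalityI subsetI)
    fix w assume "w \<in> ?E"
    then obtain p where "p \<in> P" and "w = tuple (1 * n) (\<lambda>k. tuple 1 (\<lambda>_. p) (k mod 1) (X k) (v k))"
      by (elim CollectE exE conjE) simp
    then show "w \<in> values_at P n X v" by (simp add: tuple_in_values_at)
  next
    fix w assume "w \<in> values_at P n X v"
    then obtain p where "p \<in> P" and "w = tuple n (\<lambda>k. p (X k) (v k))"
      unfolding values_at_def by (elim CollectE exE conjE)
    then show "w \<in> ?E"
      by (intro CollectI exI[of _ "tuple 1 (\<lambda>_. p)"] conjI exI[of _ p]) simp_all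
  qed
  then show ?thesis using evaluation[of n X v] by (simp only: mult_1)
qed

section \<open>Invariance and approximation\<close>

text \<open>Applying a coordinate map after \<open>p\<close> is the composition of two members of the basis, so the
  coordinate maps send the value set into itself; continuity extends this to the closure.\<close>

lemma closure_values_at_jointly_invariant:
  assumes "space_over S L" and "compatible_structure S L Z" and "structure_basis L Z P"
  shows "jointly_invariant L n m X
    (power_top euclidean (n * m) closure_of values_at P (n * m) (\<lambda>k. X (k mod n)) v)"
  unfolding jointly_invariant_def invariant_under_def
proof
  fix l assume l: "l \<in> L"
  let ?T = "power_top euclidean (n * m)"
  let ?V = "values_at P (n * m) (\<lambda>k. X (k mod n)) v"
  let ?D = "dsum (n * m) (\<lambda>k. l (X (k mod n)))"
  have "l x \<in> End_H S" for x
    using assms(1) l by (auto simp: space_over_def)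
  then have "continuous_map ?T ?T ?D"
    by (intro continuous_map_dsum) (simp add: End_H_def)
  then have "?D ` (?T closure_of ?V) \<subseteq> ?T closure_of (?D ` ?V)"
    by (rule continuous_map_image_closure_subset)
  also have "?D ` ?V \<subseteq> ?V"
  proof
    fix w assume "w \<in> ?D ` ?V"
    then obtain p where p: "p \<in> P"
      and w: "w = ?D (tuple (n * m) (\<lambda>k. p (X (k mod n)) (v k)))"
      by (auto simp: values_at_def)
    have "(\<lambda>x. l x \<circ> p x) \<in> P"
      using structure_basis_comp[OF assms(2,3) _ p] assms(3) l
      by (auto simp: structure_basis_def)
    then have "tuple (n * m) (\<lambda>k. (l (X (k mod n)) \<circ> p (X (k mod n))) (v k)) \<in> ?V"
      by (rule tuple_in_values_at)
    then show "w \<in> ?V"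
      by (simp add: w dsum_tuple)
  qed
  then have "?T closure_of (?D ` ?V) \<subseteq> ?T closure_of ?V"
    by (rule closure_of_mono)
  finally show "?D ` (?T closure_of ?V) \<subseteq> ?T closure_of ?V" .
qed

text \<open>The closure of the value set is a legitimate test set for \<open>f\<close>, and it contains \<open>v\<close> itself,
  the value of the constant identity.\<close>

lemma H_level_imp_approximable:
  assumes "structured_space euclidean S" and "space_over S L"
    and "compatible_structure S L Z" and "structure_basis L Z P"
    and f: "f \<in> H_level S L n m"
  shows "tuple (n * m) (\<lambda>k. f (X (k mod n)) (v k))
    \<in> power_top euclidean (n * m) closure_of values_at P (n * m) (\<lambda>k. X (k mod n)) v"
    (is "_ \<in> ?T closure_of ?V")
proof -
  have "?T closure_of ?V \<in> S (n * m)"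
    using assms(1) values_at_structured[OF assms(3,4)] by (simp add: structured_space_def)
  then have inv: "invariant_under n m (\<lambda>i. f (X i)) (?T closure_of ?V)"
    using f closure_values_at_jointly_invariant[OF assms(2-4)] by (simp add: H_level_def)
  have "tuple (n * m) v \<in> ?V"
    using tuple_in_values_at[OF structure_basis_id[OF assms(3,4)], where v = v] by simp
  then have "tuple (n * m) v \<in> ?T closure_of ?V"
    using closure_of_subset[OF values_at_subset_topspace] by blast
  then have "dsum (n * m) (\<lambda>k. f (X (k mod n))) (tuple (n * m) v) \<in> ?T closure_of ?V"
    using inv unfolding invariant_under_def by blast
  then show ?thesis by (simp add: dsum_tuple)
qed

text \<open>An invariant closed set that contains \<open>v\<close> contains the images of \<open>v\<close> under all members of \<open>P\<close>,
  hence also the limits of such images.\<close>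

lemma approximable_imp_H_level:
  assumes P: "P \<subseteq> H_level S L n m" and "f \<in> UNIV \<rightarrow> End_H S"
    and appr: "\<And>X v. tuple (n * m) (\<lambda>k. f (X (k mod n)) (v k))
      \<in> power_top euclidean (n * m) closure_of values_at P (n * m) (\<lambda>k. X (k mod n)) v"
  shows "f \<in> H_level S L n m"
proof -
  have "invariant_under n m (\<lambda>i. f (X i)) A"
    if A: "A \<in> S (n * m)" "closedin (power_top euclidean (n * m)) A" "jointly_invariant L n m X A"
    for X A
    unfolding invariant_under_def
  proof (rule image_subsetI)
    fix v assume v: "v \<in> A"
    have "values_at P (n * m) (\<lambda>k. X (k mod n)) v \<subseteq> A"
    proof
      fix w assume "w \<in> values_at P (n * m) (\<lambda>k. X (k mod n)) v"
      then obtain p where "p \<in> P" and w: "w = dsum (n * m) (\<lambda>k. p (X (k mod n))) v"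
        by (auto simp: values_at_def dsum_def)
      then have "invariant_under n m (\<lambda>i. p (X i)) A"
        using P A unfolding H_level_def by blast
      then show "w \<in> A"
        using v unfolding w invariant_under_def by blast
    qed
    then have "power_top euclidean (n * m) closure_of values_at P (n * m) (\<lambda>k. X (k mod n)) v \<subseteq> A"
      using A(2) by (rule closure_of_minimal)
    then show "dsum (n * m) (\<lambda>k. f (X (k mod n))) v \<in> A"
      using appr[of X v] by (auto simp: dsum_def)
  qed
  then show ?thesis
    using assms(2) by (simp add: H_level_def)
qed

lemma H_level_iff_approximable:
  assumes "structured_space euclidean S" and "space_over S L"
    and "compatible_structure S L Z" and "structure_basis L Z P"
    and "f \<in> UNIV \<rightarrow> End_H S"
  shows "f \<in> H_level S L n m \<longleftrightarrow>
    (\<forall>X v. tuple (n * m) (\<lambda>k. f (X (k mod n)) (v k))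
      \<in> power_top euclidean (n * m) closure_of values_at P (n * m) (\<lambda>k. X (k mod n)) v)"
proof
  assume "f \<in> H_level S L n m"
  then show "\<forall>X v. tuple (n * m) (\<lambda>k. f (X (k mod n)) (v k))
      \<in> power_top euclidean (n * m) closure_of values_at P (n * m) (\<lambda>k. X (k mod n)) v"
    using H_level_imp_approximable[OF assms(1-4)] by blast
next
  assume appr: "\<forall>X v. tuple (n * m) (\<lambda>k. f (X (k mod n)) (v k))
      \<in> power_top euclidean (n * m) closure_of values_at P (n * m) (\<lambda>k. X (k mod n)) v"
  have "P \<subseteq> H_level S L n m"
    using structure_basis_subset_H_all[OF assms(3,4)] by (auto simp: H_all_def H_N_def)
  then show "f \<in> H_level S L n m"
    using assms(5) appr by (intro approximable_imp_H_level) auto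
qed

lemma closure_values_at_eq:
  assumes "finite_exact_approximation P"
  shows "power_top euclidean n closure_of values_at P n X v = values_at P n X v"
  using assms by (simp add: finite_exact_approximation_def closure_of_closedin)

theorem theorem2p28:
  fixes S :: "'h::topological_space power_sets"
    and L :: "('t \<Rightarrow> 'h \<Rightarrow> 'h) set"
    and Z :: "('t \<Rightarrow> 'h \<Rightarrow> 'h) power_sets"
    and P :: "('t \<Rightarrow> 'h \<Rightarrow> 'h) set"
    and N :: nat
    and f :: "'t \<Rightarrow> 'h \<Rightarrow> 'h"
  assumes "structured_space euclidean S"
    and "space_over S L"
    and "compatible_structure S L Z"
    and "denotes_P L Z P"
    and "f \<in> UNIV \<rightarrow> End_H S"
  shows "(f \<in> H_level S L N 1 \<longleftrightarrow>
      (\<forall>X v. tuple N (\<lambda>i. f (X i) (v i)) \<in> power_top euclidean N closure_of values_at P N X v))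
    \<and> (finite_exact_approximation P \<longrightarrow>
      (f \<in> H_level S L N 1 \<longleftrightarrow>
      (\<forall>X v. \<exists>p\<in>P. \<forall>i<N. f (X i) (v i) = p (X i) (v i))))
    \<and> (f \<in> H_N S L N \<longleftrightarrow>
      (\<forall>m X v. tuple (N * m) (\<lambda>k. f (X (k mod N)) (v k))
         \<in> power_top euclidean (N * m) closure_of values_at P (N * m) (\<lambda>k. X (k mod N)) v))
    \<and> (finite_exact_approximation P \<longrightarrow>
      (f \<in> H_N S L N \<longleftrightarrow>
      (\<forall>m X v. \<exists>p\<in>P. \<forall>k<N * m. f (X (k mod N)) (v k) = p (X (k mod N)) (v k))))"
proof -
  let ?one = "\<forall>X v. tuple N (\<lambda>i. f (X i) (v i))
      \<in> power_top euclidean N closure_of values_at P N X v"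
  let ?all = "\<forall>m X v. tuple (N * m) (\<lambda>k. f (X (k mod N)) (v k))
      \<in> power_top euclidean (N * m) closure_of values_at P (N * m) (\<lambda>k. X (k mod N)) v"
  have "structure_basis L Z P"
    using assms(4) by (simp add: denotes_P_def)
  note level = H_level_iff_approximable[OF assms(1-3) this assms(5)]
  have one: "f \<in> H_level S L N 1 \<longleftrightarrow> ?one"
  proof -
    have "tuple (N * 1) (\<lambda>k. f (X (k mod N)) (v k)) = tuple N (\<lambda>k. f (X k) (v k))" for X v
      unfolding mult_1_right by (rule tuple_cong) simp
    moreover have "values_at P (N * 1) (\<lambda>k. X (k mod N)) v = values_at P N X v" for X v
      unfolding mult_1_right by (rule values_at_cong) simp
    ultimately show ?thesis
      unfolding level mult_1_right by presburger
  qed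
  have all: "f \<in> H_N S L N \<longleftrightarrow> ?all"
    unfolding H_N_def INT_iff level by simp
  have exact_one: "?one \<longleftrightarrow> (\<forall>X v. \<exists>p\<in>P. \<forall>i<N. f (X i) (v i) = p (X i) (v i))"
    if "finite_exact_approximation P"
    unfolding closure_values_at_eq[OF that]
    by (intro all_cong1 tuple_in_values_at_iff)
  have exact_all: "?all \<longleftrightarrow>
      (\<forall>m X v. \<exists>p\<in>P. \<forall>k<N * m. f (X (k mod N)) (v k) = p (X (k mod N)) (v k))"
    if "finite_exact_approximation P"
    unfolding closure_values_at_eq[OF that]
    by (intro all_cong1 tuple_in_values_at_iff)
  show ?thesis
  proof (intro conjI impI)
    assume exact: "finite_exact_approximation P"
    show "f \<in> H_level S L N 1 \<longleftrightarrow> (\<forall>X v. \<exists>p\<in>P. \<forall>i<N. f (X i) (v i) = p (X i) (v i))"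
      by (rule trans[OF one exact_one[OF exact]])
    show "f \<in> H_N S L N \<longleftrightarrow>
        (\<forall>m X v. \<exists>p\<in>P. \<forall>k<N * m. f (X (k mod N)) (v k) = p (X (k mod N)) (v k))"
      by (rule trans[OF all exact_all[OF exact]])
  qed (rule one all)+
qed

end
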